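(* Let $V$ be a vacuum-free vertex algebra. For all $u,v,w\in V$: (weak commutativity) there exists $m_1\ge0$ such that $(x_1-x_2)^{m_1}\left(Y(u,x_1)Y(v,x_2)-Y(v,x_2)Y(u,x_1)\right)=0$; (weak associativity) there exists $m_2\ge0$ such that $(x_0+x_2)^{m_2}\left(Y(u,x_0+x_2)Y(v,x_2)w-Y(Y(u,x_0)v,x_2)w\right)=0$; (weak skew-associativity) there exists $m_3\ge0$ such that $(x_1-x_0)^{m_3}\left(Y(v,-x_0+x_1)Y(u,x_1)w-Y(Y(u,x_0)v,x_1-x_0)w\right)=0$; (formal commutativity) there exist $p_1(x_1,x_2)\in V[[x_1,x_2]]$ and $a_1,b_1,c_1\ge0$ such that $$Y(u,x_1)Y(v,x_2)w=\frac{p_1(x_1,x_2)}{(x_1-x_2)^{a_1}x_1^{b_1}x_2^{c_1}}\quad\text{and}\quad Y(v,x_2)Y(u,x_1)w=\frac{p_1(x_1,x_2)}{(-x_2+x_1)^{a_1}x_1^{b_1}x_2^{c_1}};$$ (formal associativity) there exist $p_2(x_0,x_2)\in V[[x_0,x_2]]$ and $a_2,b_2,c_2\ge0$ such that $$Y(u,x_0+x_2)Y(v,x_2)w=\frac{p_2(x_0,x_2)}{x_0^{a_2}(x_0+x_2)^{b_2}x_2^{c_2}}\quad\text{and}\quad Y(Y(u,x_0)v,x_2)w=\frac{p_2(x_0,x_2)}{x_0^{a_2}(x_2+x_0)^{b_2}x_2^{c_2}};$$ (formal skew-associativity) there exist $p_3(x_0,x_1)\in V[[x_0,x_1]]$ and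 $a_3,b_3,c_3\ge0$ such that $$Y(v,-x_0+x_1)Y(u,x_1)w=\frac{p_3(x_0,x_1)}{x_0^{a_3}x_1^{b_3}(-x_0+x_1)^{c_3}}\quad\text{and}\quad Y(Y(u,x_0)v,x_1-x_0)w=\frac{p_3(x_0,x_1)}{x_0^{a_3}x_1^{b_3}(x_1-x_0)^{c_3}}.$$ (All $m_i,a_i,b_i,c_i$ are integers.)
   Context: All vector spaces are over $\mathbb C$; formal variables commute. For a vector space $U$, $U[[x,x^{-1}]]$ is the space of all formal Laurent series $\sum_{n\in\mathbb Z}u_nx^n$ with $u_n\in U$; $U((x))$ is the subspace of series with $u_n=0$ for $n$ sufficiently negative; $U[[x,y]]$ is the space of formal power series. $\delta(x)=\sum_{n\in\mathbb Z}x^n$. Binomial expansion convention: for every $n\in\mathbb Z$, $(x+y)^n=\sum_{k\ge0}\binom nk x^{n-k}y^k$, i.e. binomials are expanded in nonnegative powers of the second-listed variable (likewise with signs, so $(x_1-x_2)^n$ is expanded in nonnegative powers of $x_2$ and $(-x_2+x_1)^n$ in nonnegative powers of $x_1$); this applies inside $\delta$, to denominators, and to substitutions such as $F(x+y)$. The map $Y$ is extended coefficientwise to series: $Y(Y(u,x_0)v,x_2)=\sum_n Y(u_nv,x_2)x_0^{-n-1}$. A vacuum-free vertex algebra is a vector space $V$ with an injective linear map $Y(\cdot,x):V\to(\mathrm{End}\,V)[[x,x^{-1}]]$, $v\mapsto Y(v,x)=\sum_{n\in\mathbb Z}v_nx^{-n-1}$, such that $Y(u,x)v\in V((x))$ for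 all $u,v\in V$ and the Jacobi identity holds for all $u,v\in V$: $$x_0^{-1}\delta\left(\tfrac{x_1-x_2}{x_0}\right)Y(u,x_1)Y(v,x_2)-x_0^{-1}\delta\left(\tfrac{-x_2+x_1}{x_0}\right)Y(v,x_2)Y(u,x_1)=x_1^{-1}\delta\left(\tfrac{x_2+x_0}{x_1}\right)Y(Y(u,x_0)v,x_2).$$ *)

theory Defs
  imports Complex_Main "HOL-Library.Groups_Big_Fun" "HOL-Library.Product_Plus"
begin

text \<open>
  A formal series is its coefficient function on exponents: a series in one variable is a function
  on \<open>int\<close>, a series in the ordered list of variables (x, y) a function on \<open>int \<times> int\<close> whose value
  at (i, j) is the coefficient of x^i y^j, and likewise for three variables. The exponents are
  ordered by the index of the variable: (x1, x2), (x0, x2), (x0, x1) and (x0, x1, x2).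
  \<open>prod.swap\<close> turns a series in (x, y) into the same series with its variables listed as (y, x).

  Infinite sums of coefficients are \<^const>\<open>Sum_any\<close>, which is 0 on families without finite
  support. The lemmas below show that none of the sums used for vertex algebras is of that kind.
\<close>

definition conv :: "('a \<Rightarrow> 'b \<Rightarrow> 'c) \<Rightarrow> ('e \<Rightarrow> 'a) \<Rightarrow> ('e \<Rightarrow> 'b) \<Rightarrow> 'e::ab_group_add \<Rightarrow> 'c::comm_monoid_add"
  where "conv f A B = (\<lambda>e. Sum_any (\<lambda>d. f (A d) (B (e - d))))"

definition monomial :: "int \<times> int \<Rightarrow> int \<times> int \<Rightarrow> complex"
  where "monomial d = (\<lambda>e. if e = d then 1 else 0)"

text \<open>
  The expansion of (s x + t y)^n in nonnegative powers of the second-listed variable y, as a series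
  in (x, y). The signs s and t are always 1 or -1. The series (-x2 + x1)^n in (x1, x2) is thus
  \<open>binom_series (-1) 1 n \<circ> prod.swap\<close>. A quotient by powers of binomials and variables is
  the product with the corresponding \<open>binom_series\<close> and \<open>monomial\<close> of negative exponents.
\<close>

definition binom_series :: "complex \<Rightarrow> complex \<Rightarrow> int \<Rightarrow> int \<times> int \<Rightarrow> complex"
  where "binom_series s t n =
    (\<lambda>(i, j). if i + j = n \<and> 0 \<le> j then (of_int n gchoose nat j) * s powi i * t powi j else 0)"

text \<open>
  The series z^(-1) delta(g / z), the sum over all integers n of g^n z^(-n-1), where \<open>P n\<close> is the
  expansion of g^n. The exponent of z comes first.
\<close>

definition delta_series :: "(int \<Rightarrow> 'e \<Rightarrow> complex) \<Rightarrow> int \<times> 'e \<Rightarrow> complex"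
  where "delta_series P = (\<lambda>(i, e). P (- i - 1) e)"

definition power_series2 :: "(int \<times> int \<Rightarrow> 'v::zero) \<Rightarrow> bool"
  where "power_series2 p \<longleftrightarrow> (\<forall>i j. i < 0 \<or> j < 0 \<longrightarrow> p (i, j) = 0)"

text \<open>
  \<open>subst_binom scale s t A\<close> is A(s x + t y) as a series in (x, y), the sum of A_n (s x + t y)^n.
\<close>

definition subst_binom ::
    "(complex \<Rightarrow> 'v \<Rightarrow> 'v) \<Rightarrow> complex \<Rightarrow> complex \<Rightarrow> (int \<Rightarrow> 'v) \<Rightarrow> int \<times> int \<Rightarrow> 'v::ab_group_add"
  where "subst_binom scale s t A = (\<lambda>e. Sum_any (\<lambda>n. scale (binom_series s t n e) (A n)))"

text \<open>
  The vertex operator map: \<open>Y u k\<close> is the coefficient of x^k in Y(u, x), so that the mode u_n is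
  \<open>Y u (- n - 1)\<close>. Identities between series with coefficients in End V, whose sums are meant
  pointwise, are stated on every vector of V.
\<close>

type_synonym 'v vertex_map = "'v \<Rightarrow> int \<Rightarrow> 'v \<Rightarrow> 'v"

text \<open>Y(u, x) Y(v, y) w in (x, y).\<close>

definition vprod :: "'v vertex_map \<Rightarrow> 'v \<Rightarrow> 'v \<Rightarrow> 'v \<Rightarrow> int \<times> int \<Rightarrow> 'v"
  where "vprod Y u v w = (\<lambda>(i, j). Y u i (Y v j w))"

text \<open>Y(Y(u, x) v, y) w in (x, y).\<close>

definition viter :: "'v vertex_map \<Rightarrow> 'v \<Rightarrow> 'v \<Rightarrow> 'v \<Rightarrow> int \<times> int \<Rightarrow> 'v"
  where "viter Y u v w = (\<lambda>(i, j). Y (Y u i v) j w)"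

text \<open>Y(u, s x + t y) Y(v, y) w in (x, y).\<close>

definition vprod_subst ::
    "(complex \<Rightarrow> 'v \<Rightarrow> 'v) \<Rightarrow> 'v vertex_map \<Rightarrow> complex \<Rightarrow> complex \<Rightarrow> 'v \<Rightarrow> 'v \<Rightarrow> 'v \<Rightarrow> int \<times> int \<Rightarrow> 'v::ab_group_add"
  where "vprod_subst scale Y s t u v w =
    conv (\<lambda>T z. T z)
      (\<lambda>e z. subst_binom scale s t (\<lambda>n. Y u n z) e)
      (\<lambda>(i, j). if i = 0 then Y v j w else 0)"

text \<open>
  Y(Y(u, x) v, s y + t x) w in (x, y): the sum over k of x^k Y(u_(-k-1) v, s y + t x) w, where the
  inner series is one in (y, x).
\<close>

definition viter_subst ::
    "(complex \<Rightarrow> 'v \<Rightarrow> 'v) \<Rightarrow> 'v vertex_map \<Rightarrow> complex \<Rightarrow> complex \<Rightarrow> 'v \<Rightarrow> 'v \<Rightarrow> 'v \<Rightarrow> int \<times> int \<Rightarrow> 'v::ab_group_add"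
  where "viter_subst scale Y s t u v w =
    (\<lambda>(i, j). Sum_any (\<lambda>k. subst_binom scale s t (\<lambda>n. Y (Y u k v) n w) (j, i - k)))"

locale pre_vertex_algebra = vector_space scale
  for scale :: "complex \<Rightarrow> 'v::ab_group_add \<Rightarrow> 'v" +
  fixes Y :: "'v vertex_map"
  assumes Y_linear: "Vector_Spaces.linear scale scale (\<lambda>u. Y u k w)"
    and coeff_linear: "Vector_Spaces.linear scale scale (Y u k)"
    and truncation: "\<exists>N. \<forall>k<N. Y u k v = 0"

locale vacuum_free_vertex_algebra = pre_vertex_algebra +
  assumes Y_inj: "inj Y"
    and Jacobi:
      "conv scale
         (\<lambda>(i, j, k). delta_series (binom_series 1 (-1)) (i, (j, k)))
         (\<lambda>(i, j, k). if i = 0 then Y u j (Y v k w) else 0) e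
       - conv scale
         (\<lambda>(i, j, k). delta_series (binom_series (-1) 1) (i, (k, j)))
         (\<lambda>(i, j, k). if i = 0 then Y v k (Y u j w) else 0) e
       = conv scale
         (\<lambda>(i, j, k). delta_series (binom_series 1 1) (j, (k, i)))
         (\<lambda>(i, j, k). if j = 0 then Y (Y u i v) k w else 0) e"

lemma binom_series_nonzero: "binom_series s t n (i, j) \<noteq> 0 \<Longrightarrow> i + j = n \<and> 0 \<le> j"
  by (auto simp: binom_series_def split: if_splits)

lemma finite_binom_series_nat: "finite {d. binom_series s t (int m) d \<noteq> 0}"
proof (rule finite_subset)
  show "{d. binom_series s t (int m) d \<noteq> 0} \<subseteq> (\<lambda>j. (int m - int j, int j)) ` {0..m}"
  proof (clarify)
    fix i j assume nz: "binom_series s t (int m) (i, j) \<noteq> 0"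
    then have ij: "i + j = int m" "0 \<le> j" using binom_series_nonzero by blast+
    have "complex_of_nat (m choose nat j) \<noteq> 0"
      using nz ij by (auto simp: binom_series_def binomial_gbinomial)
    then have "nat j \<le> m" by (metis binomial_eq_0 not_le of_nat_0)
    then show "(i, j) \<in> (\<lambda>j. (int m - int j, int j)) ` {0..m}"
      using ij by (intro image_eqI[of _ _ "nat j"]) auto
  qed
qed simp

lemma conv_monomial:
  fixes scale :: "complex \<Rightarrow> 'v::ab_group_add \<Rightarrow> 'v"
  assumes "vector_space scale"
  shows "conv scale (monomial d) p e = p (e - d)"
proof -
  interpret v: vector_space scale by fact
  have "{c. scale (monomial d c) (p (e - c)) \<noteq> 0} \<subseteq> {d}"
    by (auto simp: monomial_def split: if_splits)
  then show ?thesis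
    unfolding conv_def by (subst Sum_any.expand_superset[of "{d}"]) (auto simp: monomial_def)
qed

lemma finite_quotient:
  assumes "vector_space (scale :: complex \<Rightarrow> 'v::ab_group_add \<Rightarrow> 'v)" and p: "power_series2 p"
  shows "finite {d. scale (binom_series s t n d) (conv scale (monomial c) p (e - d)) \<noteq> 0}"
      (is "finite {d. ?P d}")
    and "finite {d. scale ((binom_series s t n \<circ> prod.swap) d) (conv scale (monomial c) p (e - d)) \<noteq> 0}"
      (is "finite {d. ?Q d}")
proof -
  interpret vector_space scale by fact
  obtain a b a' b' where e: "e = (a, b)" and c: "c = (a', b')" by (cases e, cases c)
  have "d \<in> (\<lambda>j. (n - j, j)) ` {0..b - b'}" if "?P d" for d
  proof -
    obtain i j where d: "d = (i, j)" by (cases d)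
    have nz: "binom_series s t n (i, j) \<noteq> 0" "p (a - i - a', b - j - b') \<noteq> 0"
      using that by (auto simp: e c d conv_monomial[OF assms(1)])
    have "\<not> b - j - b' < 0" using p nz(2) unfolding power_series2_def by blast
    then show ?thesis
      using binom_series_nonzero[OF nz(1)] by (intro image_eqI[of _ _ j]) (auto simp: d)
  qed
  then have "{d. ?P d} \<subseteq> (\<lambda>j. (n - j, j)) ` {0..b - b'}" by blast
  then show "finite {d. ?P d}" by (rule finite_subset) simp
  have "d \<in> (\<lambda>i. (i, n - i)) ` {0..a - a'}" if "?Q d" for d
  proof -
    obtain i j where d: "d = (i, j)" by (cases d)
    have nz: "binom_series s t n (j, i) \<noteq> 0" "p (a - i - a', b - j - b') \<noteq> 0"
      using that by (auto simp: e c d conv_monomial[OF assms(1)])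
    have "\<not> a - i - a' < 0" using p nz(2) unfolding power_series2_def by blast
    then show ?thesis
      using binom_series_nonzero[OF nz(1)] by (intro image_eqI[of _ _ i]) (auto simp: d)
  qed
  then have "{d. ?Q d} \<subseteq> (\<lambda>i. (i, n - i)) ` {0..a - a'}" by blast
  then show "finite {d. ?Q d}" by (rule finite_subset) simp
qed

context pre_vertex_algebra
begin

lemma Y_zero [simp]: "Y 0 k w = 0" "Y u k 0 = 0"
proof -
  interpret l: Vector_Spaces.linear scale scale "\<lambda>u. Y u k w" by (rule Y_linear)
  interpret r: Vector_Spaces.linear scale scale "Y u k" by (rule coeff_linear)
  show "Y 0 k w = 0" "Y u k 0 = 0" using l.zero r.zero by auto
qed

lemma subst_binom_support: "{n. scale (binom_series s t n (i, j)) (A n) \<noteq> 0} \<subseteq> {i + j}"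
  using binom_series_nonzero by fastforce

lemma finite_subst_binom: "finite {n. scale (binom_series s t n (i, j)) (A n) \<noteq> 0}"
  using subst_binom_support by (rule finite_subset) simp

lemma subst_binom_eq:
  "subst_binom scale s t A (i, j) = scale (binom_series s t (i + j) (i, j)) (A (i + j))"
  unfolding subst_binom_def
  by (subst Sum_any.expand_superset[OF _ subst_binom_support]) auto

lemma finite_vprod_subst:
  "finite {d. (\<lambda>z. subst_binom scale s t (\<lambda>n. Y u n z) d)
      ((\<lambda>(i, j). if i = 0 then Y v j w else 0) (e - d)) \<noteq> 0}" (is "finite {d. ?P d}")
proof -
  obtain N where N: "\<And>k. k < N \<Longrightarrow> Y v k w = 0" using truncation by blast
  obtain a b where e: "e = (a, b)" by (cases e)
  have "d \<in> {a} \<times> {0..b - N}" if "?P d" for d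
  proof -
    obtain i j where d: "d = (i, j)" by (cases d)
    have nz: "binom_series s t (i + j) (i, j) \<noteq> 0" "a = i" "Y v (b - j) w \<noteq> 0"
      using that by (auto simp: e d subst_binom_eq split: if_splits)
    have "\<not> b - j < N" using N nz(3) by blast
    then show ?thesis using nz(2) binom_series_nonzero[OF nz(1)] by (simp add: d)
  qed
  then have "{d. ?P d} \<subseteq> {a} \<times> {0..b - N}" by blast
  then show ?thesis by (rule finite_subset) simp
qed

lemma finite_viter_subst:
  "finite {k. subst_binom scale s t (\<lambda>n. Y (Y u k v) n w) (j, i - k) \<noteq> 0}" (is "finite {k. ?P k}")
proof -
  obtain N where N: "\<And>k. k < N \<Longrightarrow> Y u k v = 0" using truncation by blast
  have "k \<in> {N..i}" if "?P k" for k
  proof -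
    have nz: "binom_series s t (j + (i - k)) (j, i - k) \<noteq> 0" "Y u k v \<noteq> 0"
      using that by (auto simp: subst_binom_eq)
    have "\<not> k < N" using N nz(2) by blast
    then show ?thesis using binom_series_nonzero[OF nz(1)] by simp
  qed
  then have "{k. ?P k} \<subseteq> {N..i}" by blast
  then show ?thesis by (rule finite_subset) simp
qed

lemma finite_Jacobi1:
  "finite {d. scale ((\<lambda>(i, j, k). delta_series (binom_series 1 (-1)) (i, (j, k))) d)
      ((\<lambda>(i, j, k). if i = 0 then Y u j (Y v k w) else 0) (e - d)) \<noteq> 0}" (is "finite {d. ?P d}")
proof -
  obtain N where N: "\<And>k. k < N \<Longrightarrow> Y v k w = 0" using truncation by blast
  obtain a b c where e: "e = (a, b, c)" by (cases e)
  have "d \<in> (\<lambda>k. (a, - a - 1 - k, k)) ` {0..c - N}" if "?P d" for d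
  proof -
    obtain i j k where d: "d = (i, j, k)" by (cases d)
    have nz: "binom_series 1 (-1) (- i - 1) (j, k) \<noteq> 0" "a = i" "Y v (c - k) w \<noteq> 0"
      using that by (auto simp: e d delta_series_def split: if_splits)
    have "\<not> c - k < N" using N nz(3) by blast
    then show ?thesis
      using nz(2) binom_series_nonzero[OF nz(1)] by (intro image_eqI[of _ _ k]) (auto simp: d)
  qed
  then have "{d. ?P d} \<subseteq> (\<lambda>k. (a, - a - 1 - k, k)) ` {0..c - N}" by blast
  then show ?thesis by (rule finite_subset) simp
qed

lemma finite_Jacobi2:
  "finite {d. scale ((\<lambda>(i, j, k). delta_series (binom_series (-1) 1) (i, (k, j))) d)
      ((\<lambda>(i, j, k). if i = 0 then Y v k (Y u j w) else 0) (e - d)) \<noteq> 0}" (is "finite {d. ?P d}")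
proof -
  obtain N where N: "\<And>k. k < N \<Longrightarrow> Y u k w = 0" using truncation by blast
  obtain a b c where e: "e = (a, b, c)" by (cases e)
  have "d \<in> (\<lambda>k. (a, k, - a - 1 - k)) ` {0..b - N}" if "?P d" for d
  proof -
    obtain i j k where d: "d = (i, j, k)" by (cases d)
    have nz: "binom_series (-1) 1 (- i - 1) (k, j) \<noteq> 0" "a = i" "Y u (b - j) w \<noteq> 0"
      using that by (auto simp: e d delta_series_def split: if_splits)
    have "\<not> b - j < N" using N nz(3) by blast
    then show ?thesis
      using nz(2) binom_series_nonzero[OF nz(1)] by (intro image_eqI[of _ _ j]) (auto simp: d)
  qed
  then have "{d. ?P d} \<subseteq> (\<lambda>k. (a, k, - a - 1 - k)) ` {0..b - N}" by blast
  then show ?thesis by (rule finite_subset) simp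
qed

lemma finite_Jacobi3:
  "finite {d. scale ((\<lambda>(i, j, k). delta_series (binom_series 1 1) (j, (k, i))) d)
      ((\<lambda>(i, j, k). if j = 0 then Y (Y u i v) k w else 0) (e - d)) \<noteq> 0}" (is "finite {d. ?P d}")
proof -
  obtain N where N: "\<And>k. k < N \<Longrightarrow> Y u k v = 0" using truncation by blast
  obtain a b c where e: "e = (a, b, c)" by (cases e)
  have "d \<in> (\<lambda>k. (k, b, - b - 1 - k)) ` {0..a - N}" if "?P d" for d
  proof -
    obtain i j k where d: "d = (i, j, k)" by (cases d)
    have nz: "binom_series 1 1 (- j - 1) (k, i) \<noteq> 0" "b = j" "Y u (a - i) v \<noteq> 0"
      using that by (auto simp: e d delta_series_def split: if_splits)
    have "\<not> a - i < N" using N nz(3) by blast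
    then show ?thesis
      using nz(2) binom_series_nonzero[OF nz(1)] by (intro image_eqI[of _ _ i]) (auto simp: d)
  qed
  then have "{d. ?P d} \<subseteq> (\<lambda>k. (k, b, - b - 1 - k)) ` {0..a - N}" by blast
  then show ?thesis by (rule finite_subset) simp
qed

end

end

theory Submission
  imports Defs "HOL-Computational_Algebra.Formal_Power_Series"
begin

text \<open>
  Fix \<open>u\<close>, \<open>v\<close>, \<open>w\<close> and compare coefficients of \<open>x0^i x1^j x2^k\<close> in the Jacobi identity. Each
  of the three terms is then a coefficient of a series multiplied by a power of a binomial
  (\<open>Jacobi_binom_series\<close>): the powers are \<open>(x1 - x2)^(-i-1)\<close> and \<open>(-x2 + x1)^(-i-1)\<close> on the left
  and \<open>(x2 + x0)^(-j-1)\<close> on the right. By truncation, the first term vanishes if \<open>k\<close> is very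
  negative, the second if \<open>j\<close> is, and the third if \<open>i\<close> is. Choosing the exponent \<open>-m-1\<close> in
  the respective variable removes one term and leaves an equation between the other two, and the
  three choices give the three weak properties.

  For \<open>i = -m-1\<close> the two remaining terms carry the factors \<open>(x1 - x2)^m\<close> and \<open>(-x2 + x1)^m\<close>, which
  are the same polynomial; this is weak commutativity. For \<open>j = -m-1\<close> the iterate is multiplied by
  \<open>(x2 + x0)^m\<close>, but the product is met as a family of residues in \<open>x1\<close>, indexed by \<open>i\<close>; for
  \<open>k = -m-1\<close> both remaining terms are families of residues in \<open>x2\<close>. The identity
  \<open>(-i-1 choose l) = (-1)^l (i+l choose l)\<close> turns such a residue into a coefficient of the series
  with a binomial substituted for its first variable, multiplied by the \<open>m\<close>-th power of that
  binomial (\<open>residue_shear\<close>). Both \<open>Y(u, s x + t y) Y(v, y) w\<close> and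
  \<open>Y(Y(u, x) v, s y + t x) w\<close> are substitutions of this form, and weak associativity and weak
  skew-associativity result.

  Each formal property follows from its weak counterpart by one general argument
  (\<open>common_quotient\<close>). If two series \<open>G\<close> and \<open>H\<close> agree after multiplication by
  \<open>(s x + t y)^m\<close>, and the exponents of \<open>y\<close> in \<open>G\<close> and those of \<open>x\<close> in \<open>H\<close> are bounded below, then
  in the common product both exponents are bounded below, so that it is a power series up to a
  monomial. Dividing by the binomial recovers \<open>G\<close> or \<open>H\<close>, according to the direction of expansion;
  that this division is legitimate is the associativity of multiplication by binomial powers
  (\<open>conv_binom_series_add\<close>), which rests on the Vandermonde identity and on truncation.
\<close>

section \<open>Sums of coefficients\<close>

text \<open>
  Families of infinite support are included: both sums are then 0, since \<open>h\<close> matches the two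
  supports. The coefficient formulas below thus hold before finiteness of any sum is known.
\<close>

lemma Sum_any_reindex:
  fixes f :: "'b \<Rightarrow> 'c::comm_monoid_add"
  assumes "inj h" and "\<And>x. f x \<noteq> 0 \<Longrightarrow> x \<in> range h"
  shows "Sum_any f = Sum_any (\<lambda>y. f (h y))"
proof -
  have supp: "{x. f x \<noteq> 0} = h ` {y. f (h y) \<noteq> 0}"
    using assms(2) by blast
  have "sum f {x. f x \<noteq> 0} = sum (\<lambda>y. f (h y)) {y. f (h y) \<noteq> 0}"
    unfolding supp using assms(1) by (subst sum.reindex) (auto intro: inj_on_subset)
  then show ?thesis
    by (simp add: Sum_any.expand_set)
qed

lemma Sum_any_nat_bounded:
  fixes f :: "nat \<Rightarrow> 'c::comm_monoid_add"
  assumes "\<And>l. K \<le> l \<Longrightarrow> f l = 0"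
  shows "Sum_any f = (\<Sum>l<K. f l)"
  using assms by (intro Sum_any.expand_superset) (auto simp: not_less[symmetric])

lemma conv_swap:
  fixes A :: "'b::ab_group_add \<times> 'a::ab_group_add \<Rightarrow> 'c"
  shows "conv f (A \<circ> prod.swap) B = conv f A (B \<circ> prod.swap) \<circ> prod.swap"
proof
  fix e :: "'a \<times> 'b"
  have "x \<in> range prod.swap" for x :: "'a \<times> 'b"
    by (intro image_eqI[of _ _ "prod.swap x"]) auto
  then show "conv f (A \<circ> prod.swap) B e = (conv f A (B \<circ> prod.swap) \<circ> prod.swap) e"
    unfolding conv_def o_def
    by (subst Sum_any_reindex[of prod.swap]) (auto simp: minus_prod_def)
qed

text \<open>
  A nonnegative power of a binomial is a polynomial, so that the direction of expansion is
  immaterial. Negative powers have two different expansions.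
\<close>

lemma binom_series_nat_swap:
  "binom_series s t (int m) \<circ> prod.swap = binom_series t s (int m)"
proof
  fix e :: "int \<times> int"
  obtain i j where e: "e = (i, j)" by (cases e)
  have zero: "(complex_of_nat m gchoose nat k) = 0" if "k > int m" for k
    using that by (simp add: binomial_gbinomial[symmetric] binomial_eq_0)
  have sym: "(complex_of_nat m gchoose nat i) = (complex_of_nat m gchoose nat j)"
    if "0 \<le> i" "0 \<le> j" "i + j = int m"
  proof -
    have "nat i \<le> m" "nat j = m - nat i" using that by auto
    then show ?thesis by (metis binomial_gbinomial binomial_symmetric)
  qed
  show "(binom_series s t (int m) \<circ> prod.swap) e = binom_series t s (int m) e"
    using zero[of i] zero[of j] sym
    by (auto simp: e binom_series_def algebra_simps)
qed

text \<open>
  Coefficient by coefficient, \<open>(s x + t y)^m (s x + t y)^n = (s x + t y)^(m + n)\<close>; the powers of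
  \<open>s\<close> and \<open>t\<close> factor out and the Vandermonde identity for generalized binomials remains. With
  \<open>s = 0\<close> it would fail, as \<open>s powi n\<close> is then not additive in \<open>n\<close>.
\<close>

lemma binom_series_Vandermonde:
  assumes "s \<noteq> 0"
  shows "(\<Sum>j\<le>l. binom_series s t m (m - int j, int j) *
            binom_series s t n (n - int (l - j), int (l - j)))
       = binom_series s t (m + n) (m + n - int l, int l)"
proof -
  have "binom_series s t m (m - int j, int j) *
          binom_series s t n (n - int (l - j), int (l - j))
      = (of_int m gchoose j) * (of_int n gchoose (l - j))
          * (s powi (m + n - int l) * t powi int l)" if "j \<le> l" for j
  proof -
    have "m + n - int l = (m - int j) + (n - int (l - j))"
      using that by simp
    then have "s powi (m + n - int l) = s powi (m - int j) * s powi (n - int (l - j))"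
      by (simp only: power_int_add[OF disjI1[OF assms]])
    moreover have "t powi int l = t powi int j * t powi int (l - j)"
      unfolding power_int_of_nat using that by (simp flip: power_add)
    ultimately show ?thesis by (simp add: binom_series_def)
  qed
  then have "(\<Sum>j\<le>l. binom_series s t m (m - int j, int j) *
            binom_series s t n (n - int (l - j), int (l - j)))
     = (\<Sum>j\<le>l. (of_int m gchoose j) * (of_int n gchoose (l - j)))
          * (s powi (m + n - int l) * t powi int l)"
    by (simp add: sum_distrib_right)
  also have "(\<Sum>j\<le>l. (of_int m gchoose j) * (of_int n gchoose (l - j)))
      = (of_int (m + n) gchoose l :: complex)"
    using gbinomial_Vandermonde[of "of_int m :: complex" "of_int n" l] by (simp add: atMost_atLeast0)
  finally show ?thesis by (simp add: binom_series_def)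
qed

section \<open>Multiplication by powers of a binomial\<close>

text \<open>
  Expansions in nonnegative powers of the second variable can be multiplied with exactly those
  series in which the exponent of the second variable is bounded below uniformly in the first
  exponent. For expansions in the first variable the condition is imposed on the swapped series.
\<close>

definition bounded_below_snd :: "(int \<times> int \<Rightarrow> 'v::zero) \<Rightarrow> bool"
  where "bounded_below_snd G \<longleftrightarrow> (\<exists>N. \<forall>i j. j < N \<longrightarrow> G (i, j) = 0)"

locale formal_series_space = vector_space scale
  for scale :: "complex \<Rightarrow> 'v::ab_group_add \<Rightarrow> 'v"
begin

lemma conv_binom_series:
  "conv scale (binom_series s t n) G (a, b)
   = (\<Sum>l. scale (binom_series s t n (n - int l, int l)) (G (a - n + int l, b - int l)))"
proof -
  have "d \<in> range (\<lambda>l. (n - int l, int l))"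
    if "scale (binom_series s t n d) (G ((a, b) - d)) \<noteq> 0" for d
  proof -
    obtain i j where d: "d = (i, j)" by (cases d)
    have "i + j = n" "0 \<le> j" using that binom_series_nonzero[of s t n i j] by (auto simp: d)
    then show ?thesis
      by (intro image_eqI[of _ _ "nat j"]) (auto simp: d)
  qed
  moreover have "inj (\<lambda>l. (n - int l, int l))"
    by (simp add: inj_on_def)
  moreover have "(a, b) - (n - int l, int l) = (a - n + int l, b - int l)" for l
    by simp
  ultimately show ?thesis
    unfolding conv_def by (subst Sum_any_reindex) (assumption | simp only: refl)+
qed

lemma conv_binom_series_bounded:
  assumes "\<And>i j. j < N \<Longrightarrow> G (i, j) = 0" and "b < N + int K"
  shows "conv scale (binom_series s t n) G (a, b)
   = (\<Sum>l<K. scale (binom_series s t n (n - int l, int l)) (G (a - n + int l, b - int l)))"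
  unfolding conv_binom_series using assms by (intro Sum_any_nat_bounded) auto

lemma conv_binom_series_eq_0:
  assumes "\<And>i j. j < N \<Longrightarrow> G (i, j) = 0" and "b < N"
  shows "conv scale (binom_series s t n) G (a, b) = 0"
  using conv_binom_series_bounded[of N G b 0] assms by simp

text \<open>
  Expanding twice in nonnegative powers of the same variable and collecting terms by the total
  exponent \<open>l = j + k\<close>. The inner coefficients may depend on \<open>j\<close>, which is needed when the inner
  expansion comes from a substitution.
\<close>

lemma sum_iterated_expansion:
  fixes G :: "nat \<Rightarrow> 'v"
  shows "(\<Sum>j<K. scale (\<alpha> j) (\<Sum>k<K - j. scale (\<beta> j k) (G (j + k))))
   = (\<Sum>l<K. scale (\<Sum>j\<le>l. \<alpha> j * \<beta> j (l - j)) (G l))"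
proof -
  have "(\<Sum>j<K. scale (\<alpha> j) (\<Sum>k<K - j. scale (\<beta> j k) (G (j + k))))
      = (\<Sum>j<K. \<Sum>k<K - j. scale (\<alpha> j * \<beta> j k) (G (j + k)))"
    by (simp add: scale_sum_right)
  also have "\<dots> = (\<Sum>(j, k)\<in>(SIGMA j:{..<K}. {..<K - j}). scale (\<alpha> j * \<beta> j k) (G (j + k)))"
    by (subst sum.Sigma) auto
  also have "(SIGMA j:{..<K}. {..<K - j}) = {(j, k). j + k < K}"
    by auto
  also have "(\<Sum>(j, k)\<in>{(j, k). j + k < K}. scale (\<alpha> j * \<beta> j k) (G (j + k)))
      = (\<Sum>l<K. \<Sum>j\<le>l. scale (\<alpha> j * \<beta> j (l - j)) (G (j + (l - j))))"
    by (rule sum.triangle_reindex)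
  also have "\<dots> = (\<Sum>l<K. scale (\<Sum>j\<le>l. \<alpha> j * \<beta> j (l - j)) (G l))"
    by (simp add: scale_sum_left)
  finally show ?thesis .
qed

text \<open>
  Products of three formal series are not associative in general. Here truncation makes every
  coefficient a finite double sum, and collecting terms leaves the Vandermonde identity.
\<close>

lemma conv_binom_series_add:
  assumes "s \<noteq> 0" and "bounded_below_snd G"
  shows "conv scale (binom_series s t m) (conv scale (binom_series s t n) G)
       = conv scale (binom_series s t (m + n)) G"
proof
  fix e :: "int \<times> int"
  obtain a b where e: "e = (a, b)" by (cases e)
  obtain N where N: "\<And>i j. j < N \<Longrightarrow> G (i, j) = 0"
    using assms(2) unfolding bounded_below_snd_def by blast
  define K where "K = nat (b - N + 1)"
  have K: "b < N + int K" by (simp add: K_def)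
  have "conv scale (binom_series s t m) (conv scale (binom_series s t n) G) (a, b)
      = (\<Sum>j<K. scale (binom_series s t m (m - int j, int j))
          (conv scale (binom_series s t n) G (a - m + int j, b - int j)))"
    using N K by (intro conv_binom_series_bounded[where N = N] conv_binom_series_eq_0[of N G])
  also have "\<dots> = (\<Sum>j<K. scale (binom_series s t m (m - int j, int j))
        (\<Sum>k<K - j. scale (binom_series s t n (n - int k, int k))
          (G (a - (m + n) + int (j + k), b - int (j + k)))))"
  proof (intro sum.cong refl arg_cong[of _ _ "scale _"])
    fix j assume "j \<in> {..<K}"
    then have "b - int j < N + int (K - j)" using K by auto
    from conv_binom_series_bounded[of N G "b - int j", OF N this]
    show "conv scale (binom_series s t n) G (a - m + int j, b - int j)
      = (\<Sum>k<K - j. scale (binom_series s t n (n - int k, int k))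
          (G (a - (m + n) + int (j + k), b - int (j + k))))"
      by (simp add: algebra_simps)
  qed
  also have "\<dots> = (\<Sum>l<K. scale (binom_series s t (m + n) (m + n - int l, int l))
      (G (a - (m + n) + int l, b - int l)))"
    using sum_iterated_expansion[of "\<lambda>j. binom_series s t m (m - int j, int j)"
        "\<lambda>j k. binom_series s t n (n - int k, int k)"
        "\<lambda>l. G (a - (m + n) + int l, b - int l)" K]
    unfolding binom_series_Vandermonde[OF assms(1)] .
  also have "\<dots> = conv scale (binom_series s t (m + n)) G (a, b)"
    using N K by (intro conv_binom_series_bounded[of N G, symmetric])
  finally show "conv scale (binom_series s t m) (conv scale (binom_series s t n) G) e
      = conv scale (binom_series s t (m + n)) G e"
    by (simp add: e)
qed

lemma conv_binom_series_0: "conv scale (binom_series s t 0) G = G"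
proof -
  have "binom_series s t 0 = monomial 0"
  proof
    fix e :: "int \<times> int"
    obtain i j where e: "e = (i, j)" by (cases e)
    have "(0::complex) gchoose nat j = 0" if "j > 0"
      using that gbinomial_0_left[of "nat j", where 'a = complex] by simp
    then show "binom_series s t 0 e = monomial 0 e"
      by (cases "j = 0") (auto simp: e binom_series_def monomial_def zero_prod_def)
  qed
  then show ?thesis
    by (simp only: fun_eq_iff[of "conv _ _ _"] conv_monomial[OF vector_space_axioms] diff_zero
          simp_thms)
qed

lemma conv_binom_series_inverse:
  assumes "s \<noteq> 0" and "bounded_below_snd G"
  shows "conv scale (binom_series s t (- n)) (conv scale (binom_series s t n) G) = G"
  using conv_binom_series_add[OF assms, of t "- n" n] by (simp add: conv_binom_series_0)

text \<open>
  The multiplier has finite support, which makes the product additive in arbitrary formal series.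
  The weak properties need this generality: the two series subtracted there are bounded below in
  different variables.
\<close>

lemma conv_binom_series_diff:
  "conv scale (binom_series s t (int m)) (\<lambda>e. G e - H e) e
   = conv scale (binom_series s t (int m)) G e - conv scale (binom_series s t (int m)) H e"
proof -
  let ?B = "binom_series s t (int m)"
  have fin: "finite {d. scale (?B d) (A d) \<noteq> 0}" for A
    by (rule finite_subset[OF _ finite_binom_series_nat[of s t m]]) auto
  have fin': "finite {d. - scale (?B d) (A d) \<noteq> 0}" for A
    using fin[of A] by simp
  have "Sum_any (\<lambda>d. scale (?B d) (G (e - d)) + (- scale (?B d) (H (e - d))))
      = Sum_any (\<lambda>d. scale (?B d) (G (e - d))) + Sum_any (\<lambda>d. - scale (?B d) (H (e - d)))"
    by (rule Sum_any.distrib[OF fin fin'])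
  moreover have "Sum_any (\<lambda>d. - scale (?B d) (H (e - d))) = - Sum_any (\<lambda>d. scale (?B d) (H (e - d)))"
    by (simp add: Sum_any.expand_set sum_negf)
  ultimately show ?thesis
    unfolding conv_def by (simp add: scale_right_diff_distrib)
qed

section \<open>Series that agree after clearing a binomial\<close>

text \<open>
  The common product \<open>F\<close> inherits from \<open>G\<close> a lower bound on the exponent of the second variable
  and from \<open>H\<close> one on the first, so that a monomial shift makes it a power series. Each factor is
  recovered by the expansion of the inverse power for which it is truncated.
\<close>

lemma common_quotient:
  assumes st: "s \<noteq> 0" "t \<noteq> 0"
    and G: "bounded_below_snd G" and H: "bounded_below_snd (H \<circ> prod.swap)"
    and eq: "conv scale (binom_series s t (int m)) G = conv scale (binom_series s t (int m)) H"
  shows "\<exists>p (b::nat) (c::nat). power_series2 p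
    \<and> G = conv scale (binom_series s t (- int m)) (conv scale (monomial (- int b, - int c)) p)
    \<and> H = conv scale (binom_series t s (- int m) \<circ> prod.swap)
            (conv scale (monomial (- int b, - int c)) p)"
proof -
  define F where "F = conv scale (binom_series s t (int m)) G"
  have F_swap: "F \<circ> prod.swap = conv scale (binom_series t s (int m)) (H \<circ> prod.swap)"
  proof -
    have "F = conv scale (binom_series t s (int m) \<circ> prod.swap) H"
      unfolding F_def eq binom_series_nat_swap ..
    then show ?thesis
      unfolding conv_swap by (simp add: o_assoc[symmetric])
  qed
  obtain N where N: "\<And>i j. j < N \<Longrightarrow> G (i, j) = 0"
    using G unfolding bounded_below_snd_def by blast
  obtain M where M: "\<And>i j. j < M \<Longrightarrow> (H \<circ> prod.swap) (i, j) = 0"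
    using H unfolding bounded_below_snd_def by blast
  have F1: "F (i, j) = 0" if "j < N" for i j
    unfolding F_def using conv_binom_series_eq_0[of N G] N that by blast
  have F2: "F (i, j) = 0" if "i < M" for i j
    using conv_binom_series_eq_0[of M "H \<circ> prod.swap" i t s "int m" j] M that F_swap[symmetric] by simp
  \<comment> \<open>If a lower bound is already positive, no shift is needed and \<open>nat\<close> gives 0.\<close>
  define b c where "b = nat (- M)" and "c = nat (- N)"
  define p where "p = conv scale (monomial (int b, int c)) F"
  have "power_series2 p"
    unfolding power_series2_def p_def
  proof (intro allI impI)
    fix i j :: int assume "i < 0 \<or> j < 0"
    then have "i - int b < M \<or> j - int c < N" by (auto simp: b_def c_def)
    then show "conv scale (monomial (int b, int c)) F (i, j) = 0"
      using F1 F2 by (auto simp: conv_monomial[OF vector_space_axioms])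
  qed
  moreover have p: "conv scale (monomial (- int b, - int c)) p = F"
    unfolding p_def by (auto simp: fun_eq_iff conv_monomial[OF vector_space_axioms])
  moreover have "G = conv scale (binom_series s t (- int m)) F"
    unfolding F_def by (rule conv_binom_series_inverse[OF st(1) G, symmetric])
  moreover have "H = conv scale (binom_series t s (- int m) \<circ> prod.swap) F"
    unfolding conv_swap F_swap conv_binom_series_inverse[OF st(2) H]
    by (simp add: o_assoc[symmetric])
  ultimately show ?thesis by metis
qed

section \<open>Substitution of a binomial\<close>

text \<open>
  The series \<open>H(s x + t y, y)\<close> in \<open>(x, y)\<close>: the monomial \<open>x^(a + l) y^(b - l)\<close> of \<open>H\<close> contributes
  to \<open>x^a y^b\<close> through the term of \<open>(s x + t y)^(a + l)\<close> with \<open>l\<close> factors \<open>y\<close>.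
\<close>

definition shear :: "complex \<Rightarrow> complex \<Rightarrow> (int \<times> int \<Rightarrow> 'v) \<Rightarrow> int \<times> int \<Rightarrow> 'v"
  where "shear s t H = (\<lambda>(a, b).
    \<Sum>l. scale (binom_series s t (a + int l) (a, int l)) (H (a + int l, b - int l)))"

lemma shear_bounded:
  assumes "\<And>i j. j < N \<Longrightarrow> H (i, j) = 0" and "b < N + int K"
  shows "shear s t H (a, b)
   = (\<Sum>l<K. scale (binom_series s t (a + int l) (a, int l)) (H (a + int l, b - int l)))"
  unfolding shear_def prod.case using assms by (intro Sum_any_nat_bounded) auto

lemma shear_eq_0:
  assumes "\<And>i j. j < N \<Longrightarrow> H (i, j) = 0" and "b < N"
  shows "shear s t H (a, b) = 0"
  using shear_bounded[of N H b 0] assms by simp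

lemma bounded_below_snd_shear:
  assumes "bounded_below_snd H" shows "bounded_below_snd (shear s t H)"
  using assms shear_eq_0 unfolding bounded_below_snd_def by metis

text \<open>
  Multiplying by \<open>(s x + t y)^m\<close> after the substitution is multiplying by \<open>x^m\<close> before it.
\<close>

lemma conv_binom_series_shear:
  assumes "s \<noteq> 0" and "bounded_below_snd H"
  shows "conv scale (binom_series s t m) (shear s t H) = shear s t (\<lambda>(i, j). H (i - m, j))"
proof
  fix e :: "int \<times> int"
  obtain a b where e: "e = (a, b)" by (cases e)
  obtain N where N: "\<And>i j. j < N \<Longrightarrow> H (i, j) = 0"
    using assms(2) unfolding bounded_below_snd_def by blast
  define K where "K = nat (b - N + 1)"
  have K: "b < N + int K" by (simp add: K_def)
  have "conv scale (binom_series s t m) (shear s t H) (a, b)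
      = (\<Sum>j<K. scale (binom_series s t m (m - int j, int j))
          (shear s t H (a - m + int j, b - int j)))"
    using N K by (intro conv_binom_series_bounded[where N = N] shear_eq_0[of N H])
  also have "\<dots> = (\<Sum>j<K. scale (binom_series s t m (m - int j, int j))
        (\<Sum>k<K - j. scale (binom_series s t (a - m + int (j + k)) (a - m + int j, int k))
          (H (a - m + int (j + k), b - int (j + k)))))"
  proof (intro sum.cong refl arg_cong[of _ _ "scale _"])
    fix j assume "j \<in> {..<K}"
    then have "b - int j < N + int (K - j)" using K by auto
    from shear_bounded[of N H "b - int j", OF N this]
    show "shear s t H (a - m + int j, b - int j)
      = (\<Sum>k<K - j. scale (binom_series s t (a - m + int (j + k)) (a - m + int j, int k))
          (H (a - m + int (j + k), b - int (j + k))))"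
      by (simp add: algebra_simps)
  qed
  also have "\<dots> = (\<Sum>l<K. scale (\<Sum>j\<le>l. binom_series s t m (m - int j, int j) *
        binom_series s t (a - m + int (j + (l - j))) (a - m + int j, int (l - j)))
      (H (a - m + int l, b - int l)))"
    by (rule sum_iterated_expansion[of "\<lambda>j. binom_series s t m (m - int j, int j)"
        "\<lambda>j k. binom_series s t (a - m + int (j + k)) (a - m + int j, int k)"
        "\<lambda>l. H (a - m + int l, b - int l)" K])
  also have "\<dots> = (\<Sum>l<K. scale (binom_series s t (a + int l) (a, int l))
      (H (a - m + int l, b - int l)))"
  proof (intro sum.cong refl arg_cong2[of _ _ _ _ scale])
    fix l
    have "(\<Sum>j\<le>l. binom_series s t m (m - int j, int j) *
        binom_series s t (a - m + int (j + (l - j))) (a - m + int j, int (l - j)))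
      = (\<Sum>j\<le>l. binom_series s t m (m - int j, int j) *
        binom_series s t (a - m + int l) (a - m + int l - int (l - j), int (l - j)))"
    proof (intro sum.cong refl)
      fix j assume "j \<in> {..l}"
      then have "j + (l - j) = l" and "a - m + int j = a - m + int l - int (l - j)" by auto
      then show "binom_series s t m (m - int j, int j) *
          binom_series s t (a - m + int (j + (l - j))) (a - m + int j, int (l - j))
        = binom_series s t m (m - int j, int j) *
          binom_series s t (a - m + int l) (a - m + int l - int (l - j), int (l - j))"
        by (simp only:)
    qed
    then show "(\<Sum>j\<le>l. binom_series s t m (m - int j, int j) *
        binom_series s t (a - m + int (j + (l - j))) (a - m + int j, int (l - j)))
      = binom_series s t (a + int l) (a, int l)"
      unfolding binom_series_Vandermonde[OF assms(1)] by simp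
  qed
  also have "\<dots> = shear s t (\<lambda>(i, j). H (i - m, j)) (a, b)"
    using shear_bounded[of N "\<lambda>(i, j). H (i - m, j)" _ K] N K by (simp add: algebra_simps)
  finally show "conv scale (binom_series s t m) (shear s t H) e
      = shear s t (\<lambda>(i, j). H (i - m, j)) e"
    by (simp add: e)
qed

text \<open>
  The bridge from the Jacobi identity to substituted series. Formally, taking the coefficient of
  \<open>x^(-m-1)\<close> in \<open>(s x + t y)^(-i-1) H(x, y)\<close> and reading \<open>i\<close> as the exponent of a new variable \<open>z\<close>
  is taking the residue in \<open>x\<close> of \<open>x^m H(x, y)\<close> times \<open>z^(-1) delta((s x + t y) / z)\<close>; the delta
  function substitutes \<open>x = s (z - t y) = s z - s t y\<close>, as \<open>s\<close> is its own inverse. The factor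
  \<open>s\<close> in front is the Jacobian of this substitution.
\<close>

lemma residue_shear:
  assumes s: "s = 1 \<or> s = - 1" and H: "bounded_below_snd H"
  shows "conv scale (binom_series s t (- i - 1)) H (- m - 1, k)
       = scale s (conv scale (binom_series s (- s * t) m) (shear s (- s * t) H) (i, k))"
proof -
  obtain N where N: "\<And>i j. j < N \<Longrightarrow> H (i, j) = 0"
    using H unfolding bounded_below_snd_def by blast
  define K where "K = nat (k - N + 1)"
  have K: "k < N + int K" by (simp add: K_def)
  have s0: "s \<noteq> 0" using s by auto
  have coeff: "binom_series s t (- i - 1) (- i - 1 - int l, int l)
      = s * binom_series s (- s * t) (i + int l) (i, int l)" for l
  proof -
    have "(of_int (- i - 1) gchoose l :: complex) = (- 1) ^ l * (of_int (i + int l) gchoose l)"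
      by (subst gbinomial_negated_upper) (simp add: algebra_simps)
    moreover have "s powi (- i - 1 - int l) = s * s powi i * s ^ l"
    proof -
      have inv: "inverse s = s" using s by auto
      have "- i - 1 - int l = - (i + 1 + int l)"
        by simp
      then have "s powi (- i - 1 - int l) = s powi (- (i + 1 + int l))"
        by (rule arg_cong)
      also have "\<dots> = s powi (i + 1 + int l)"
        by (simp only: power_int_minus power_int_inverse[symmetric] inv)
      also have "\<dots> = s * s powi i * s ^ l"
        using s0 by (simp add: power_int_add)
      finally show ?thesis .
    qed
    ultimately show ?thesis
      by (simp add: binom_series_def power_mult_distrib power_minus[of "s * t"])
  qed
  have "conv scale (binom_series s t (- i - 1)) H (- m - 1, k)
      = (\<Sum>l<K. scale (binom_series s t (- i - 1) (- i - 1 - int l, int l))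
          (H (i - m + int l, k - int l)))"
    using conv_binom_series_bounded[of N H k K] N K by (simp add: algebra_simps)
  also have "\<dots> = scale s (\<Sum>l<K. scale (binom_series s (- s * t) (i + int l) (i, int l))
          (H (i - m + int l, k - int l)))"
    unfolding coeff by (simp add: scale_sum_right)
  also have "(\<Sum>l<K. scale (binom_series s (- s * t) (i + int l) (i, int l))
          (H (i - m + int l, k - int l))) = shear s (- s * t) (\<lambda>(i, j). H (i - m, j)) (i, k)"
    using shear_bounded[of N "\<lambda>(i, j). H (i - m, j)" _ K] N K by (simp add: algebra_simps)
  finally show ?thesis
    unfolding conv_binom_series_shear[OF s0 H] .
qed

end

section \<open>The Jacobi identity in terms of binomial powers\<close>

sublocale pre_vertex_algebra \<subseteq> formal_series_space scale
  by unfold_locales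

context pre_vertex_algebra
begin

lemma bounded_below_snd_vprod: "bounded_below_snd (vprod Y u v w)"
  using truncation[of v w] unfolding bounded_below_snd_def vprod_def by (elim ex_forward) simp

lemma bounded_below_snd_viter: "bounded_below_snd (viter Y u v w \<circ> prod.swap)"
  using truncation[of u v] unfolding bounded_below_snd_def viter_def by (elim ex_forward) simp

lemma vprod_subst_eq_shear: "vprod_subst scale Y s t u v w = shear s t (vprod Y u v w)"
proof
  fix e :: "int \<times> int"
  obtain a b where e: "e = (a, b)" by (cases e)
  let ?f = "\<lambda>d. subst_binom scale s t
    (\<lambda>n. Y u n ((\<lambda>(i, j). if i = 0 then Y v j w else 0) ((a, b) - d))) d"
  have supp: "d \<in> range (\<lambda>l. (a, int l))" if "?f d \<noteq> 0" for d
  proof -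
    obtain i j where d: "d = (i, j)" by (cases d)
    have "i = a" "0 \<le> j"
      using that binom_series_nonzero[of s t "i + j" i j]
      by (auto simp: d subst_binom_eq split: if_splits)
    then show ?thesis
      by (intro image_eqI[of _ _ "nat j"]) (auto simp: d)
  qed
  have "vprod_subst scale Y s t u v w e = Sum_any ?f"
    unfolding vprod_subst_def conv_def e ..
  also have "\<dots> = (\<Sum>l. ?f (a, int l))"
    by (rule Sum_any_reindex[OF _ supp]) (auto simp: inj_on_def)
  also have "\<dots> = shear s t (vprod Y u v w) e"
    by (simp add: e shear_def subst_binom_eq vprod_def)
  finally show "vprod_subst scale Y s t u v w e = shear s t (vprod Y u v w) e" .
qed

lemma viter_subst_eq_shear:
  "viter_subst scale Y s t u v w = shear s t (viter Y u v w \<circ> prod.swap) \<circ> prod.swap"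
proof
  fix e :: "int \<times> int"
  obtain i j where e: "e = (i, j)" by (cases e)
  let ?f = "\<lambda>k. subst_binom scale s t (\<lambda>n. Y (Y u k v) n w) (j, i - k)"
  have supp: "k \<in> range (\<lambda>l. i - int l)" if "?f k \<noteq> 0" for k
  proof -
    have "0 \<le> i - k"
      using that binom_series_nonzero[of s t "j + (i - k)" j "i - k"]
      by (auto simp: subst_binom_eq)
    then show ?thesis
      by (intro image_eqI[of _ _ "nat (i - k)"]) auto
  qed
  have "viter_subst scale Y s t u v w e = Sum_any ?f"
    unfolding viter_subst_def e prod.case ..
  also have "\<dots> = (\<Sum>l. ?f (i - int l))"
    by (rule Sum_any_reindex[OF _ supp]) (auto simp: inj_on_def)
  also have "\<dots> = (shear s t (viter Y u v w \<circ> prod.swap) \<circ> prod.swap) e"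
    by (simp add: e shear_def subst_binom_eq viter_def)
  finally show "viter_subst scale Y s t u v w e
      = (shear s t (viter Y u v w \<circ> prod.swap) \<circ> prod.swap) e" .
qed

end

context vacuum_free_vertex_algebra
begin

text \<open>
  In each of the three products the operator part does not involve the variable in the denominator
  of the delta function, so that the power of the binomial is determined by the coefficient. The
  sum that remains is over the exponent of the variable in which the binomial is expanded.
\<close>

lemma Jacobi_binom_series:
  "conv scale (binom_series 1 (-1) (- i - 1)) (vprod Y u v w) (j, k)
   - conv scale (binom_series (-1) 1 (- i - 1)) (vprod Y v u w) (k, j)
   = conv scale (binom_series 1 1 (- j - 1)) (viter Y u v w \<circ> prod.swap) (k, i)"
proof -
  let ?A = "\<lambda>d. scale ((\<lambda>(i, j, k). delta_series (binom_series 1 (-1)) (i, (j, k))) d)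
    ((\<lambda>(i, j, k). if i = 0 then Y u j (Y v k w) else 0) ((i, j, k) - d))"
  have supp_A: "d \<in> range (\<lambda>l. (i, - i - 1 - int l, int l))" if "?A d \<noteq> 0" for d
  proof -
    obtain i' j' k' where d: "d = (i', j', k')" by (cases d)
    have "i' = i" "j' + k' = - i' - 1" "0 \<le> k'"
      using that binom_series_nonzero[of 1 "-1" "- i' - 1" j' k']
      by (auto simp: d delta_series_def split: if_splits)
    then show ?thesis
      by (intro image_eqI[of _ _ "nat k'"]) (auto simp: d)
  qed
  have "Sum_any ?A = (\<Sum>l. ?A ((i, - i - 1 - int l, int l)))"
    by (rule Sum_any_reindex[OF _ supp_A]) (auto simp: inj_on_def)
  also have "\<dots> = conv scale (binom_series 1 (-1) (- i - 1)) (vprod Y u v w) (j, k)"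
    by (simp add: conv_binom_series delta_series_def vprod_def algebra_simps)
  finally have A: "Sum_any ?A = conv scale (binom_series 1 (-1) (- i - 1)) (vprod Y u v w) (j, k)" .
  let ?B = "\<lambda>d. scale ((\<lambda>(i, j, k). delta_series (binom_series (-1) 1) (i, (k, j))) d)
    ((\<lambda>(i, j, k). if i = 0 then Y v k (Y u j w) else 0) ((i, j, k) - d))"
  have supp_B: "d \<in> range (\<lambda>l. (i, int l, - i - 1 - int l))" if "?B d \<noteq> 0" for d
  proof -
    obtain i' j' k' where d: "d = (i', j', k')" by (cases d)
    have "i' = i" "k' + j' = - i' - 1" "0 \<le> j'"
      using that binom_series_nonzero[of "-1" 1 "- i' - 1" k' j']
      by (auto simp: d delta_series_def split: if_splits)
    then show ?thesis
      by (intro image_eqI[of _ _ "nat j'"]) (auto simp: d)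
  qed
  have "Sum_any ?B = (\<Sum>l. ?B ((i, int l, - i - 1 - int l)))"
    by (rule Sum_any_reindex[OF _ supp_B]) (auto simp: inj_on_def)
  also have "\<dots> = conv scale (binom_series (-1) 1 (- i - 1)) (vprod Y v u w) (k, j)"
    by (simp add: conv_binom_series delta_series_def vprod_def algebra_simps)
  finally have B: "Sum_any ?B = conv scale (binom_series (-1) 1 (- i - 1)) (vprod Y v u w) (k, j)" .
  let ?C = "\<lambda>d. scale ((\<lambda>(i, j, k). delta_series (binom_series 1 1) (j, (k, i))) d)
    ((\<lambda>(i, j, k). if j = 0 then Y (Y u i v) k w else 0) ((i, j, k) - d))"
  have supp_C: "d \<in> range (\<lambda>l. (int l, j, - j - 1 - int l))" if "?C d \<noteq> 0" for d
  proof -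
    obtain i' j' k' where d: "d = (i', j', k')" by (cases d)
    have "j' = j" "k' + i' = - j' - 1" "0 \<le> i'"
      using that binom_series_nonzero[of 1 1 "- j' - 1" k' i']
      by (auto simp: d delta_series_def split: if_splits)
    then show ?thesis
      by (intro image_eqI[of _ _ "nat i'"]) (auto simp: d)
  qed
  have "Sum_any ?C = (\<Sum>l. ?C ((int l, j, - j - 1 - int l)))"
    by (rule Sum_any_reindex[OF _ supp_C]) (auto simp: inj_on_def)
  also have "\<dots> = conv scale (binom_series 1 1 (- j - 1)) (viter Y u v w \<circ> prod.swap) (k, i)"
    by (simp add: conv_binom_series delta_series_def viter_def algebra_simps)
  finally have C: "Sum_any ?C = conv scale (binom_series 1 1 (- j - 1)) (viter Y u v w \<circ> prod.swap) (k, i)" .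
  show ?thesis
    using Jacobi[of u v w "(i, j, k)"] unfolding conv_def A B C .
qed

section \<open>Weak commutativity, associativity and skew-associativity\<close>

text \<open>
  The truncation bound concerns \<open>u\<close> and \<open>v\<close> alone, so that one exponent serves all vectors \<open>w\<close>.
\<close>

lemma weak_commutativity:
  "\<exists>m::nat. \<forall>w. conv scale (binom_series 1 (-1) (int m)) (vprod Y u v w)
     = conv scale (binom_series 1 (-1) (int m)) (vprod Y v u w \<circ> prod.swap)"
proof -
  obtain N where N: "\<And>k. k < N \<Longrightarrow> Y u k v = 0" using truncation by blast
  define m where "m = nat (- N)"
  have "conv scale (binom_series 1 (-1) (int m)) (vprod Y u v w) (j, k)
     = conv scale (binom_series 1 (-1) (int m)) (vprod Y v u w \<circ> prod.swap) (j, k)" for w j k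
  proof -
    \<comment> \<open>The iterate contributes nothing at \<open>x0^(-m-1)\<close>, as \<open>Y(u, x0) v\<close> has no exponents below
      \<open>N \<ge> -m\<close>.\<close>
    have "conv scale (binom_series 1 1 (- j - 1)) (viter Y u v w \<circ> prod.swap) (k, - int m - 1) = 0"
      by (rule conv_binom_series_eq_0[of N]) (auto simp: viter_def N m_def)
    then show ?thesis
      using Jacobi_binom_series[of "- int m - 1" u v w j k]
        conv_swap[of scale "binom_series (-1) 1 (int m)" "vprod Y v u w \<circ> prod.swap"]
      by (simp add: binom_series_nat_swap o_assoc[symmetric])
  qed
  then show ?thesis by (auto simp: fun_eq_iff)
qed

lemma weak_associativity:
  "\<exists>m::nat. conv scale (binom_series 1 1 (int m)) (vprod_subst scale Y 1 1 u v w)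
     = conv scale (binom_series 1 1 (int m)) (viter Y u v w)"
proof -
  obtain N where N: "\<And>k. k < N \<Longrightarrow> Y u k w = 0" using truncation by blast
  define m where "m = nat (- N)"
  have "conv scale (binom_series 1 1 (int m)) (vprod_subst scale Y 1 1 u v w) (i, k)
     = conv scale (binom_series 1 1 (int m)) (viter Y u v w) (i, k)" for i k
  proof -
    \<comment> \<open>At \<open>x1^(-m-1)\<close> the product with \<open>Y(u, x1)\<close> acting first drops out.\<close>
    have "conv scale (binom_series (-1) 1 (- i - 1)) (vprod Y v u w) (k, - int m - 1) = 0"
      by (rule conv_binom_series_eq_0[of N]) (auto simp: vprod_def N m_def)
    then show ?thesis
      using Jacobi_binom_series[of i u v w "- int m - 1" k]
        conv_swap[of scale "binom_series 1 1 (int m)" "viter Y u v w"]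
        residue_shear[OF _ bounded_below_snd_vprod[of u v w], of 1 "-1" i "int m" k]
      by (simp add: binom_series_nat_swap vprod_subst_eq_shear)
  qed
  then show ?thesis by (auto simp: fun_eq_iff)
qed

lemma weak_skew_associativity:
  "\<exists>m::nat. conv scale (binom_series (-1) 1 (int m)) (vprod_subst scale Y (-1) 1 v u w)
     = conv scale (binom_series (-1) 1 (int m)) (viter_subst scale Y 1 (-1) u v w)"
proof -
  obtain N where N: "\<And>k. k < N \<Longrightarrow> Y v k w = 0" using truncation by blast
  define m where "m = nat (- N)"
  have "conv scale (binom_series (-1) 1 (int m)) (vprod_subst scale Y (-1) 1 v u w) (i, j)
     = conv scale (binom_series (-1) 1 (int m)) (viter_subst scale Y 1 (-1) u v w) (i, j)" for i j
  proof -
    \<comment> \<open>At \<open>x2^(-m-1)\<close> the product with \<open>Y(v, x2)\<close> acting first drops out. Both remaining terms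
      become substitutions, and the sign of the second cancels against the factor -1 of its
      residue.\<close>
    have "conv scale (binom_series 1 (-1) (- i - 1)) (vprod Y u v w) (j, - int m - 1) = 0"
      by (rule conv_binom_series_eq_0[of N]) (auto simp: vprod_def N m_def)
    then show ?thesis
      using Jacobi_binom_series[of i u v w j "- int m - 1"]
        conv_swap[of scale "binom_series 1 (-1) (int m)" "viter_subst scale Y 1 (-1) u v w"]
        residue_shear[OF _ bounded_below_snd_vprod[of v u w], of "-1" 1 i "int m" j]
        residue_shear[OF _ bounded_below_snd_viter[of u v w], of 1 1 j "int m" i]
      by (simp add: binom_series_nat_swap vprod_subst_eq_shear viter_subst_eq_shear
            o_assoc[symmetric])
  qed
  then show ?thesis by (auto simp: fun_eq_iff)
qed

end

theorem proposition4p1: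
  fixes scale :: "complex \<Rightarrow> 'v::ab_group_add \<Rightarrow> 'v" and Y :: "'v vertex_map" and u v w :: 'v
  assumes "vacuum_free_vertex_algebra scale Y"
  shows "(\<exists>m1::nat. \<forall>z.
         conv scale (binom_series 1 (-1) (int m1))
           (\<lambda>(i, j). vprod Y u v z (i, j) - vprod Y v u z (j, i)) = (\<lambda>_. 0))
    \<and> (\<exists>m2::nat.
         conv scale (binom_series 1 1 (int m2))
           (\<lambda>e. vprod_subst scale Y 1 1 u v w e - viter Y u v w e) = (\<lambda>_. 0))
    \<and> (\<exists>m3::nat.
         conv scale (binom_series 1 (-1) (int m3) \<circ> prod.swap)
           (\<lambda>e. vprod_subst scale Y (-1) 1 v u w e - viter_subst scale Y 1 (-1) u v w e) = (\<lambda>_. 0))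
    \<and> (\<exists>p1 (a1::nat) (b1::nat) (c1::nat). power_series2 p1 \<and>
         vprod Y u v w =
           conv scale (binom_series 1 (-1) (- int a1))
             (conv scale (monomial (- int b1, - int c1)) p1) \<and>
         vprod Y v u w \<circ> prod.swap =
           conv scale (binom_series (-1) 1 (- int a1) \<circ> prod.swap)
             (conv scale (monomial (- int b1, - int c1)) p1))
    \<and> (\<exists>p2 (a2::nat) (b2::nat) (c2::nat). power_series2 p2 \<and>
         vprod_subst scale Y 1 1 u v w =
           conv scale (binom_series 1 1 (- int b2))
             (conv scale (monomial (- int a2, - int c2)) p2) \<and>
         viter Y u v w =
           conv scale (binom_series 1 1 (- int b2) \<circ> prod.swap)
             (conv scale (monomial (- int a2, - int c2)) p2))
    \<and> (\<exists>p3 (a3::nat) (b3::nat) (c3::nat). power_series2 p3 \<and>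
         vprod_subst scale Y (-1) 1 v u w =
           conv scale (binom_series (-1) 1 (- int c3))
             (conv scale (monomial (- int a3, - int b3)) p3) \<and>
         viter_subst scale Y 1 (-1) u v w =
           conv scale (binom_series 1 (-1) (- int c3) \<circ> prod.swap)
             (conv scale (monomial (- int a3, - int b3)) p3))"
proof -
  interpret vacuum_free_vertex_algebra scale Y by fact
  obtain m1 :: nat where m1: "\<And>z. conv scale (binom_series 1 (-1) (int m1)) (vprod Y u v z)
      = conv scale (binom_series 1 (-1) (int m1)) (vprod Y v u z \<circ> prod.swap)"
    using weak_commutativity by blast
  obtain m2 :: nat where m2:
    "conv scale (binom_series 1 1 (int m2)) (vprod_subst scale Y 1 1 u v w)
      = conv scale (binom_series 1 1 (int m2)) (viter Y u v w)"
    using weak_associativity by blast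
  obtain m3 :: nat where m3:
    "conv scale (binom_series (-1) 1 (int m3)) (vprod_subst scale Y (-1) 1 v u w)
      = conv scale (binom_series (-1) 1 (int m3)) (viter_subst scale Y 1 (-1) u v w)"
    using weak_skew_associativity by blast
  have sub: "bounded_below_snd (vprod_subst scale Y s t u' v' w)" for s t u' v'
    unfolding vprod_subst_eq_shear by (intro bounded_below_snd_shear bounded_below_snd_vprod)
  have sub': "bounded_below_snd (viter_subst scale Y s t u v w \<circ> prod.swap)" for s t
    unfolding viter_subst_eq_shear
    by (simp add: o_assoc[symmetric] bounded_below_snd_shear bounded_below_snd_viter)
  have com: "(\<lambda>(i, j). vprod Y u v z (i, j) - vprod Y v u z (j, i))
      = (\<lambda>e. vprod Y u v z e - (vprod Y v u z \<circ> prod.swap) e)" for z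
    by auto
  have swapped: "bounded_below_snd ((vprod Y v u w \<circ> prod.swap) \<circ> prod.swap)"
    by (simp add: o_assoc[symmetric] bounded_below_snd_vprod)
  have one: "(1::complex) \<noteq> 0" "(- 1::complex) \<noteq> 0"
    by simp_all
  show ?thesis
  proof (intro conjI, goal_cases)
    case 1
    show ?case
      by (intro exI[of _ m1] allI ext) (simp only: com conv_binom_series_diff m1 diff_self)
  next
    case 2
    show ?case
      by (intro exI[of _ m2] ext) (simp only: conv_binom_series_diff m2 diff_self)
  next
    case 3
    show ?case
      by (intro exI[of _ m3] ext)
        (simp only: binom_series_nat_swap conv_binom_series_diff m3 diff_self)
  next
    case 4
    from common_quotient[OF one(1,2) bounded_below_snd_vprod swapped m1[of w]]
    show ?case by blast
  next
    case 5
    from common_quotient[OF one(1,1) sub bounded_below_snd_viter m2]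
    show ?case by blast
  next
    case 6
    from common_quotient[OF one(2,1) sub sub' m3]
    show ?case by blast
  qed
qed

end
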